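(* Consider the optimal control problem (OCP) and the nonlinear program (NLP) on the uniform grid $\Lambda=\{ih : i=0,\dots,N\}$, $h=T/N$, described in the context. Let $\mathcal D>0$, let $(v(g))_{g\in\Lambda}\subset\mathbb R^\nu$ be the control part of the optimizers of (NLP), and let $$\hat u(t)=\frac1{\sqrt{\pi\mathcal D}}\sum_{g\in\Lambda}v(g)\,e^{-|t-g|^2/(\mathcal Dh^2)}\in\mathbb R^\nu .$$ Let $n,m\in\mathbb N$ and let $\psi\in\mathcal C^n(\mathbb R;\mathbb R)$ be a mother wavelet having $n$ vanishing moments and satisfying, for some $K_\psi>0$, the decay condition $|\psi^{(k)}(t)|\le \frac{K_\psi}{1+|t|^m}$ for all $t\in\mathbb R$ and $k=0,\dots,n$. Then there exists a constant $A>0$, independent of $(a,b)$, such that $$|(W\hat u)(a,b)|\le A\,b^{3/2}\qquad\text{for all }(a,b)\in\mathbb R\times(0,+\infty).$$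
   Context: A mother wavelet is a measurable $\psi:\mathbb R\to\mathbb R$ with $\|\psi\|_{L^2}=1$ and $\int_{\mathbb R}\psi(t)\,dt=0$, satisfying the admissibility condition $\int_0^\infty|\hat\psi(\omega)|^2\omega^{-1}\,d\omega<\infty$, where $\hat\psi$ is the Fourier transform of $\psi$. It has $n$ vanishing moments if $\int_{\mathbb R}t^k\psi(t)\,dt=0$ for $k=0,\dots,n-1$. The wavelet transform of $w$ at time $a\in\mathbb R$ and scale $b>0$ is $$(Ww)(a,b)=\int_{\mathbb R}w(t)\frac1{\sqrt b}\,\psi\Big(\frac{t-a}{b}\Big)\,dt,$$ applied componentwise when $w$ is vector valued, $|\cdot|$ then being a norm on $\mathbb R^\nu$. The function $\hat u$ is regarded as a function on all of $\mathbb R$ through its defining formula. (OCP): given $d,\nu,\ell\in\mathbb N$, $T>0$, $\bar x\in\mathbb R^d$, minimize $c_F(x(T))+\int_0^Tc(x(t),u(t))\,dt$ over bounded measurable $u:[0,T]\to\mathbb R^\nu$ subject to $\dot x=f(x)+G(x)u$ a.e., $x(0)=\bar x$, $r_F(x(T))\le0$, $h_j(x(t),u(t))\le0$ for a.e. $t$ ($j=1,\dots,\ell$), and $u(t)\in\mathbb U$ a.e. Here: (a) $\mathbb U=\prod_{i=1}^\nu[U^i_{\min},U^i_{\max}]$ with finite $U^i_{\min}<U^i_{\max}$. (b) $f,G$ are locally Lipschitz with at most linear growth. (c) $c\ge0$ is continuous and convex, locally Lipschitz in the state, with $c(\xi,\mu)\ge\bar\alpha\|\mu\|^{\bar r}+\bar\beta$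 on admissible values for some $\bar r>1$, $\bar\alpha,\bar\beta>0$; $c_F\ge0$ is locally Lipschitz with at most linear growth. (d) The real-valued $h_j$ and $r_F$ are locally Lipschitz, with $|h_j(\xi,\mu)|\le C_\xi(1+\|\xi\|)$, $|h_j(\xi,\mu)|\le C_\mu(1+\|\mu\|)$, $|r_F(\xi)|\le C_r(1+\|\xi\|)$ for some positive constants. (NLP): with $g_i=ih$, minimize $\sum_{i=0}^{N}c_i(\eta_i,v(g_i))+c_F(\eta_N)$ over $(\eta_i,v(g_i))_{i=0}^N$ in $\mathbb R^d\times\mathbb R^\nu$ subject to $\eta_0=\bar x$; $\eta_{i+1}=x_i(g_{i+1},\eta_i,v(g_i))$ for $0\le i<N$; $h_j(\eta_i,v(g_i))\le0$ and $v(g_i)\in\mathbb U$ for all $i,j$; $r_F(\eta_N)\le0$. Here $x_i(\cdot,\eta,v)$ is the solution on $[g_i,g_{i+1}]$, computed by a suitable numerical integration scheme, of $\dot x=f(x)+G(x)v$ with $x(g_i)=\eta$ and constant control $v$, and $c_i$ is a quadrature approximation of the running cost.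
   Formalization: The formal theorem additionally assumes n ≥ 2 or m ≥ 3; for n ≤ 1 and m ≤ 2 the claim fails, e.g. for an odd C¹ wavelet equal to c/t² for t ≥ 1, where the transform can grow like b^{3/2} log(1/b) as b → 0. *)

theory Defs
  imports "HOL-Analysis.Analysis"
begin

section \<open>Regularity notions\<close>

definition locally_lipschitz :: "('a::metric_space \<Rightarrow> 'b::metric_space) \<Rightarrow> bool" where
  "locally_lipschitz f \<longleftrightarrow> (\<forall>x. \<exists>r>0. \<exists>L. L-lipschitz_on (cball x r) f)"

definition linear_growth :: "('a::real_normed_vector \<Rightarrow> 'b::real_normed_vector) \<Rightarrow> bool" where
  "linear_growth f \<longleftrightarrow> (\<exists>C>0. \<forall>x. norm (f x) \<le> C * (1 + norm x))"

definition C_class :: "nat \<Rightarrow> (real \<Rightarrow> real) \<Rightarrow> bool" where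
  "C_class n f \<longleftrightarrow>
     (\<forall>k<n. \<forall>t. (deriv ^^ k) f differentiable (at t)) \<and> continuous_on UNIV ((deriv ^^ n) f)"

definition is_norm :: "('a::real_vector \<Rightarrow> real) \<Rightarrow> bool" where
  "is_norm p \<longleftrightarrow>
     (\<forall>x. 0 \<le> p x) \<and> (\<forall>x. p x = 0 \<longleftrightarrow> x = 0) \<and>
     (\<forall>r x. p (r *\<^sub>R x) = \<bar>r\<bar> * p x) \<and> (\<forall>x y. p (x + y) \<le> p x + p y)"

section \<open>The optimal control problem\<close>

record ('d, 'n) ocp =
  horizon :: real
  x_init :: "real ^ 'd"
  drift :: "real ^ 'd \<Rightarrow> real ^ 'd"
  ctrl :: "real ^ 'd \<Rightarrow> real ^ 'n ^ 'd"
  run_cost :: "real ^ 'd \<Rightarrow> real ^ 'n \<Rightarrow> real"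
  final_cost :: "real ^ 'd \<Rightarrow> real"
  n_con :: nat
  path_con :: "nat \<Rightarrow> real ^ 'd \<Rightarrow> real ^ 'n \<Rightarrow> real"
  final_con :: "real ^ 'd \<Rightarrow> real"
  u_min :: "real ^ 'n"
  u_max :: "real ^ 'n"

definition control_box :: "('d::finite, 'n::finite) ocp \<Rightarrow> (real ^ 'n) set" where
  "control_box P = {\<mu>. \<forall>i. u_min P $ i \<le> \<mu> $ i \<and> \<mu> $ i \<le> u_max P $ i}"

definition admissible_values :: "('d::finite, 'n::finite) ocp \<Rightarrow> ((real ^ 'd) \<times> (real ^ 'n)) set" where
  "admissible_values P =
     {(\<xi>, \<mu>). \<mu> \<in> control_box P \<and> (\<forall>j\<in>{1..n_con P}. path_con P j \<xi> \<mu> \<le> 0)}"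

definition vfield :: "('d::finite, 'n::finite) ocp \<Rightarrow> real ^ 'n \<Rightarrow> real ^ 'd \<Rightarrow> real ^ 'd" where
  "vfield P \<mu> \<xi> = drift P \<xi> + ctrl P \<xi> *v \<mu>"

text \<open>The standing assumptions on the data. Local Lipschitz continuity of the path constraints
  is joint in state and control.\<close>

definition ocp_assms :: "('d::finite, 'n::finite) ocp \<Rightarrow> bool" where
  "ocp_assms P \<longleftrightarrow>
     0 < horizon P \<and>
     (\<forall>i. u_min P $ i < u_max P $ i) \<and>
     locally_lipschitz (drift P) \<and> linear_growth (drift P) \<and>
     locally_lipschitz (ctrl P) \<and> linear_growth (ctrl P) \<and>
     (\<forall>\<xi> \<mu>. 0 \<le> run_cost P \<xi> \<mu>) \<and>
     continuous_on UNIV (\<lambda>(\<xi>, \<mu>). run_cost P \<xi> \<mu>) \<and>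
     convex_on UNIV (\<lambda>(\<xi>, \<mu>). run_cost P \<xi> \<mu>) \<and>
     (\<forall>\<mu>. locally_lipschitz (\<lambda>\<xi>. run_cost P \<xi> \<mu>)) \<and>
     (\<exists>r>1. \<exists>\<alpha>>0. \<exists>\<beta>>0. \<forall>(\<xi>, \<mu>)\<in>admissible_values P.
        run_cost P \<xi> \<mu> \<ge> \<alpha> * norm \<mu> powr r + \<beta>) \<and>
     (\<forall>\<xi>. 0 \<le> final_cost P \<xi>) \<and>
     locally_lipschitz (final_cost P) \<and> linear_growth (final_cost P) \<and>
     (\<forall>j\<in>{1..n_con P}. locally_lipschitz (\<lambda>(\<xi>, \<mu>). path_con P j \<xi> \<mu>)) \<and>
     locally_lipschitz (final_con P) \<and>
     (\<exists>C>0. \<forall>j\<in>{1..n_con P}. \<forall>\<xi> \<mu>. \<bar>path_con P j \<xi> \<mu>\<bar> \<le> C * (1 + norm \<xi>)) \<and>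
     (\<exists>C>0. \<forall>j\<in>{1..n_con P}. \<forall>\<xi> \<mu>. \<bar>path_con P j \<xi> \<mu>\<bar> \<le> C * (1 + norm \<mu>)) \<and>
     (\<exists>C>0. \<forall>\<xi>. \<bar>final_con P \<xi>\<bar> \<le> C * (1 + norm \<xi>))"

text \<open>The differential equation, in the sense of Caratheodory, is written in integrated form.\<close>

definition ocp_feasible ::
  "('d::finite, 'n::finite) ocp \<Rightarrow> (real \<Rightarrow> real ^ 'd) \<Rightarrow> (real \<Rightarrow> real ^ 'n) \<Rightarrow> bool" where
  "ocp_feasible P x u \<longleftrightarrow>
     u \<in> borel_measurable (lebesgue_on {0..horizon P}) \<and> bounded (u ` {0..horizon P}) \<and>
     continuous_on {0..horizon P} x \<and>
     (\<forall>t\<in>{0..horizon P}. ((\<lambda>s. vfield P (u s) (x s)) has_integral (x t - x_init P)) {0..t}) \<and>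
     final_con P (x (horizon P)) \<le> 0 \<and>
     (AE t in lebesgue_on {0..horizon P}. (x t, u t) \<in> admissible_values P)"

definition ocp_cost ::
  "('d::finite, 'n::finite) ocp \<Rightarrow> (real \<Rightarrow> real ^ 'd) \<Rightarrow> (real \<Rightarrow> real ^ 'n) \<Rightarrow> real" where
  "ocp_cost P x u =
     final_cost P (x (horizon P)) + (LINT t|lebesgue_on {0..horizon P}. run_cost P (x t) (u t))"

definition ocp_optimal ::
  "('d::finite, 'n::finite) ocp \<Rightarrow> (real \<Rightarrow> real ^ 'd) \<Rightarrow> (real \<Rightarrow> real ^ 'n) \<Rightarrow> bool" where
  "ocp_optimal P x u \<longleftrightarrow>
     ocp_feasible P x u \<and> (\<forall>x' u'. ocp_feasible P x' u' \<longrightarrow> ocp_cost P x u \<le> ocp_cost P x' u')"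

section \<open>The nonlinear program\<close>

definition step :: "('d::finite, 'n::finite) ocp \<Rightarrow> nat \<Rightarrow> real" where
  "step P N = horizon P / real N"

definition gpt :: "('d::finite, 'n::finite) ocp \<Rightarrow> nat \<Rightarrow> nat \<Rightarrow> real" where
  "gpt P N i = real i * step P N"

definition grid :: "('d::finite, 'n::finite) ocp \<Rightarrow> nat \<Rightarrow> real set" where
  "grid P N = gpt P N ` {0..N}"

text \<open>\<open>\<Phi> F s y t\<close> is the value at time \<open>t\<close> of the numerical solution of
  \<open>x' = F x\<close>, \<open>x s = y\<close>. The scheme is left open; it has to respect
  the initial value and to be consistent, i.e. to leave \<open>y\<close> with slope \<open>F y\<close>. The exact flow,
  Runge-Kutta methods, and their variants with inner substeps are all instances.\<close>

definition integration_scheme ::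
  "((real ^ 'd \<Rightarrow> real ^ 'd) \<Rightarrow> real \<Rightarrow> real ^ 'd \<Rightarrow> real \<Rightarrow> real ^ 'd::finite) \<Rightarrow> bool" where
  "integration_scheme \<Phi> \<longleftrightarrow>
     (\<forall>F s y. locally_lipschitz F \<and> linear_growth F \<longrightarrow>
        \<Phi> F s y s = y \<and> ((\<lambda>t. \<Phi> F s y t) has_vector_derivative F y) (at s within {s..}))"

definition nlp_state where
  "nlp_state P N \<Phi> i t y \<mu> = \<Phi> (vfield P \<mu>) (gpt P N i) y t"

text \<open>A quadrature rule on \<open>[0, T]\<close>, split over the grid: the nodes \<open>S i\<close> with weights \<open>w i\<close>
  belong to the \<open>i\<close>-th step. The index \<open>i = N\<close> has the only possible node \<open>T\<close>, so that both
  nodal rules (such as the trapezoidal rule on the grid points) and composite rules are covered.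
  The last conjunct is exactness on constants.\<close>

definition quadrature_rule ::
  "('d::finite, 'n::finite) ocp \<Rightarrow> nat \<Rightarrow> (nat \<Rightarrow> real set) \<Rightarrow> (nat \<Rightarrow> real \<Rightarrow> real) \<Rightarrow> bool" where
  "quadrature_rule P N S w \<longleftrightarrow>
     (\<forall>i<N. finite (S i) \<and> S i \<subseteq> {gpt P N i..gpt P N (Suc i)}) \<and>
     S N \<subseteq> {gpt P N N} \<and>
     (\<Sum>i=0..N. \<Sum>\<tau>\<in>S i. w i \<tau>) = horizon P"

definition nlp_stage_cost where
  "nlp_stage_cost P N \<Phi> S w i y \<mu> =
     (\<Sum>\<tau>\<in>S i. w i \<tau> * run_cost P (nlp_state P N \<Phi> i \<tau> y \<mu>) \<mu>)"

definition nlp_feasible where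
  "nlp_feasible P N \<Phi> \<eta> v \<longleftrightarrow>
     \<eta> 0 = x_init P \<and>
     (\<forall>i<N. \<eta> (Suc i) = nlp_state P N \<Phi> i (gpt P N (Suc i)) (\<eta> i) (v (gpt P N i))) \<and>
     (\<forall>i\<le>N. \<forall>j\<in>{1..n_con P}. path_con P j (\<eta> i) (v (gpt P N i)) \<le> 0) \<and>
     (\<forall>i\<le>N. v (gpt P N i) \<in> control_box P) \<and>
     final_con P (\<eta> N) \<le> 0"

definition nlp_cost where
  "nlp_cost P N \<Phi> S w \<eta> v =
     (\<Sum>i=0..N. nlp_stage_cost P N \<Phi> S w i (\<eta> i) (v (gpt P N i))) + final_cost P (\<eta> N)"

text \<open>The controls are functions on the grid; values of \<open>v\<close> off the grid and of \<open>\<eta>\<close> beyond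
  \<open>N\<close> play no role.\<close>

definition nlp_optimal ::
  "('d::finite, 'n::finite) ocp \<Rightarrow> nat \<Rightarrow>
   ((real ^ 'd \<Rightarrow> real ^ 'd) \<Rightarrow> real \<Rightarrow> real ^ 'd \<Rightarrow> real \<Rightarrow> real ^ 'd) \<Rightarrow>
   (nat \<Rightarrow> real set) \<Rightarrow> (nat \<Rightarrow> real \<Rightarrow> real) \<Rightarrow>
   (nat \<Rightarrow> real ^ 'd) \<Rightarrow> (real \<Rightarrow> real ^ 'n) \<Rightarrow> bool" where
  "nlp_optimal P N \<Phi> S w \<eta> v \<longleftrightarrow>
     nlp_feasible P N \<Phi> \<eta> v \<and>
     (\<forall>\<eta>' v'. nlp_feasible P N \<Phi> \<eta>' v' \<longrightarrow>
        nlp_cost P N \<Phi> S w \<eta> v \<le> nlp_cost P N \<Phi> S w \<eta>' v')"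

definition u_hat ::
  "('d::finite, 'n::finite) ocp \<Rightarrow> nat \<Rightarrow> real \<Rightarrow> (real \<Rightarrow> real ^ 'n) \<Rightarrow> real \<Rightarrow> real ^ 'n" where
  "u_hat P N D v t =
     (1 / sqrt (pi * D)) *\<^sub>R
       (\<Sum>g\<in>grid P N. exp (- (\<bar>t - g\<bar>\<^sup>2 / (D * (step P N)\<^sup>2))) *\<^sub>R v g)"

section \<open>Wavelets\<close>

definition fourier :: "(real \<Rightarrow> real) \<Rightarrow> real \<Rightarrow> complex" where
  "fourier f \<omega> = (LINT t|lborel. complex_of_real (f t) * exp (- (\<i> * complex_of_real (\<omega> * t))))"

text \<open>The integral conditions are stated with \<^const>\<open>has_bochner_integral\<close>, since the bare
  integral of a non-integrable function is \<open>0\<close>.\<close>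

definition mother_wavelet :: "(real \<Rightarrow> real) \<Rightarrow> bool" where
  "mother_wavelet \<psi> \<longleftrightarrow>
     \<psi> \<in> borel_measurable lborel \<and>
     has_bochner_integral lborel (\<lambda>t. (\<psi> t)\<^sup>2) 1 \<and>
     has_bochner_integral lborel \<psi> 0 \<and>
     set_integrable lborel {0<..} (\<lambda>\<omega>. (cmod (fourier \<psi> \<omega>))\<^sup>2 / \<omega>)"

definition vanishing_moments :: "nat \<Rightarrow> (real \<Rightarrow> real) \<Rightarrow> bool" where
  "vanishing_moments n \<psi> \<longleftrightarrow> (\<forall>k<n. has_bochner_integral lborel (\<lambda>t. t ^ k * \<psi> t) 0)"

definition wavelet_transform ::
  "(real \<Rightarrow> real) \<Rightarrow> (real \<Rightarrow> real) \<Rightarrow> real \<Rightarrow> real \<Rightarrow> real" where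
  "wavelet_transform \<psi> w a b = (LINT t|lborel. w t * (1 / sqrt b) * \<psi> ((t - a) / b))"

definition wavelet_transform_vec ::
  "(real \<Rightarrow> real) \<Rightarrow> (real \<Rightarrow> real ^ 'n::finite) \<Rightarrow> real \<Rightarrow> real \<Rightarrow> real ^ 'n" where
  "wavelet_transform_vec \<psi> w a b = (\<chi> i. wavelet_transform \<psi> (\<lambda>t. w t $ i) a b)"

end

theory Submission imports Defs "HOL-Probability.Sinc_Integral" begin

text \<open>
  A zero mean turns \<open>(W w)(a, b)\<close> into
  \<open>\<integral> (w t - w a) \<psi> ((t - a) / b) / \<surd>b dt\<close>. If \<open>w\<close> is \<open>L\<close>-Lipschitz, substituting \<open>t = a + b s\<close>
  bounds this by \<open>b\<^bsup>3/2\<^esup> L \<integral> \<bar>s \<psi> s\<bar> ds\<close>. The first absolute moment is finite because \<open>t \<psi> t\<close> is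
  integrable when \<open>n \<ge> 2\<close>, and by the decay condition when \<open>m \<ge> 3\<close>. A finite combination
  of Gaussians is Lipschitz.
\<close>

text \<open>Mean value inequality: it suffices to bound the derivative. The constant is deliberately
  crude, which avoids locating the extrema of the derivative.\<close>

lemma gaussian_lipschitz:
  fixes c g :: real
  assumes "c > 0"
  shows "\<bar>exp (- (\<bar>x - g\<bar>\<^sup>2 / c)) - exp (- (\<bar>y - g\<bar>\<^sup>2 / c))\<bar> \<le> ((1 + c) / c) * \<bar>x - y\<bar>"
proof -
  let ?d = "\<lambda>x. exp (- ((x - g)\<^sup>2 / c)) * (- (2 * (x - g) / c))"
  have "norm (exp (- ((x - g)\<^sup>2 / c)) - exp (- ((y - g)\<^sup>2 / c))) \<le> ((1 + c) / c) * norm (x - y)"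
  proof (rule field_differentiable_bound[where S = UNIV and f' = ?d])
    fix z :: real
    show "((\<lambda>x. exp (- ((x - g)\<^sup>2 / c))) has_field_derivative ?d z) (at z within UNIV)"
      using assms by (auto intro!: derivative_eq_intros simp: power2_eq_square field_simps)
    define q where "q = (z - g)\<^sup>2"
    have "\<bar>2 * (z - g)\<bar> = 2 * \<bar>z - g\<bar>"
      by (simp only: abs_mult abs_numeral)
    also have "\<dots> \<le> 1 + q"
      using sum_squares_bound[of "\<bar>z - g\<bar>" 1] by (simp add: q_def)
    finally have "\<bar>2 * (z - g)\<bar> \<le> 1 + q" .
    \<comment> \<open>Expanding the right side gives \<open>1 + q\<close> plus the nonnegative terms
      \<open>c\<close> and \<open>q / c\<close>. This form lets \<open>1 + y \<le> exp y\<close>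
      with \<open>y = q / c\<close> cancel the Gaussian factor.\<close>
    also have "1 + q \<le> (1 + c) * (1 + q / c)"
      using assms by (simp add: field_simps q_def)
    also have "\<dots> \<le> (1 + c) * exp (q / c)"
      using assms by (intro mult_left_mono exp_ge_add_one_self) auto
    finally have "exp (- (q / c)) * \<bar>2 * (z - g)\<bar> \<le> 1 + c"
      by (simp add: exp_minus field_simps)
    then have "exp (- (q / c)) * \<bar>2 * (z - g)\<bar> / c \<le> (1 + c) / c"
      using assms by (intro divide_right_mono) auto
    then show "norm (?d z) \<le> (1 + c) / c"
      using assms by (simp add: q_def abs_mult)
  qed auto
  then show ?thesis by simp
qed

text \<open>All the Gaussians share the width \<open>c\<close>, so one Lipschitz constant serves
  every grid point; in a linear combination these constants add up, weighted by the absolute values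
  of the coefficients.\<close>

lemma u_hat_component_lipschitz:
  fixes P :: "('d::finite, 'n::finite) ocp"
  assumes "D > 0" "step P N > 0"
  shows "\<exists>L. L-lipschitz_on UNIV (\<lambda>t. u_hat P N D v t $ i)"
proof -
  define c where "c = D * (step P N)\<^sup>2"
  have c: "c > 0" using assms by (simp add: c_def)
  define G where "G g t = exp (- (\<bar>t - g\<bar>\<^sup>2 / c))" for g t :: real
  define k where "k = 1 / sqrt (pi * D)"
  have k: "k \<ge> 0" using assms by (simp add: k_def)
  have u: "u_hat P N D v t $ i = k * (\<Sum>g\<in>grid P N. G g t * v g $ i)" for t
    by (simp add: u_hat_def G_def k_def c_def)
  let ?L = "k * (\<Sum>g\<in>grid P N. (1 + c) / c * \<bar>v g $ i\<bar>)"
  have "?L-lipschitz_on UNIV (\<lambda>t. u_hat P N D v t $ i)"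
  proof (rule lipschitz_onI)
    fix x y :: real
    have "\<bar>(\<Sum>g\<in>grid P N. (G g x - G g y) * v g $ i)\<bar>
        \<le> (\<Sum>g\<in>grid P N. \<bar>(G g x - G g y) * v g $ i\<bar>)"
      by (rule sum_abs)
    also have "\<dots> \<le> (\<Sum>g\<in>grid P N. ((1 + c) / c * \<bar>v g $ i\<bar>) * \<bar>x - y\<bar>)"
    proof (rule sum_mono)
      fix g
      have "\<bar>G g x - G g y\<bar> * \<bar>v g $ i\<bar> \<le> ((1 + c) / c * \<bar>x - y\<bar>) * \<bar>v g $ i\<bar>"
        unfolding G_def using gaussian_lipschitz[OF c] by (intro mult_right_mono) auto
      then show "\<bar>(G g x - G g y) * v g $ i\<bar> \<le> ((1 + c) / c * \<bar>v g $ i\<bar>) * \<bar>x - y\<bar>"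
        by (simp add: abs_mult mult_ac)
    qed
    finally have "\<bar>(\<Sum>g\<in>grid P N. (G g x - G g y) * v g $ i)\<bar>
        \<le> (\<Sum>g\<in>grid P N. (1 + c) / c * \<bar>v g $ i\<bar>) * \<bar>x - y\<bar>"
      by (simp only: sum_distrib_right)
    from mult_left_mono[OF this k]
    have "k * \<bar>(\<Sum>g\<in>grid P N. (G g x - G g y) * v g $ i)\<bar> \<le> ?L * \<bar>x - y\<bar>"
      by (simp only: mult.assoc)
    then show "dist (u_hat P N D v x $ i) (u_hat P N D v y $ i) \<le> ?L * dist x y"
      using k by (simp add: u dist_real_def right_diff_distrib[symmetric] sum_subtractf[symmetric]
          left_diff_distrib[symmetric] abs_mult)
  next
    show "0 \<le> ?L" using k c by (intro mult_nonneg_nonneg sum_nonneg) auto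
  qed
  then show ?thesis ..
qed

text \<open>Three powers of \<open>b\<close> meet: \<open>b\<close> from the substitution,
  \<open>b\<close> from the Lipschitz increment and \<open>1 / sqrt b\<close> from the
  normalization. The Lipschitz constant is global, so the bound is uniform in
  \<open>a\<close>.\<close>

lemma wavelet_transform_lipschitz_bound:
  fixes \<psi> w :: "real \<Rightarrow> real"
  assumes mean: "has_bochner_integral lborel \<psi> 0"
    and moment: "integrable lborel (\<lambda>t. t * \<psi> t)"
    and lip: "L-lipschitz_on UNIV w"
    and b: "b > 0"
  shows "\<bar>wavelet_transform \<psi> w a b\<bar> \<le> (L * (LINT s|lborel. \<bar>s * \<psi> s\<bar>)) * b powr (3 / 2)"
proof -
  have int: "integrable lborel \<psi>" and zero: "(LINT s|lborel. \<psi> s) = 0"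
    using mean by (auto simp: has_bochner_integral_iff)
  have [measurable]: "\<psi> \<in> borel_measurable borel"
    using int by (auto dest: borel_measurable_integrable)
  have [measurable]: "w \<in> borel_measurable borel"
    using lipschitz_on_continuous_on[OF lip] by (rule borel_measurable_continuous_onI)
  have L: "L \<ge> 0" using lip by (rule lipschitz_on_nonneg)
  let ?f = "\<lambda>s. (w (a + b * s) - w a) * \<psi> s"
  have bound: "\<bar>?f s\<bar> \<le> L * b * \<bar>s * \<psi> s\<bar>" for s
  proof -
    have "\<bar>w (a + b * s) - w a\<bar> \<le> L * (b * \<bar>s\<bar>)"
      using lipschitz_onD[OF lip, of "a + b * s" a] b by (simp add: dist_real_def abs_mult)
    then have "\<bar>w (a + b * s) - w a\<bar> * \<bar>\<psi> s\<bar> \<le> L * (b * \<bar>s\<bar>) * \<bar>\<psi> s\<bar>"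
      by (intro mult_right_mono) auto
    then show ?thesis by (simp add: abs_mult mult_ac)
  qed
  have dom: "integrable lborel (\<lambda>s. L * b * \<bar>s * \<psi> s\<bar>)"
    using moment by auto
  \<comment> \<open>Needed before the integral of the sum below may be split.\<close>
  have f: "integrable lborel ?f"
    by (rule Bochner_Integration.integrable_bound[OF dom])
      (use bound L b in \<open>auto simp: abs_mult\<close>)
  \<comment> \<open>Substitute \<open>t = a + b * s\<close> and write \<open>w (a + b * s)\<close>
    as increment plus \<open>w a\<close>; the constant part then meets the zero mean of
    \<open>\<psi>\<close>.\<close>
  have "wavelet_transform \<psi> w a b = b * (LINT s|lborel. (1 / sqrt b) * (?f s + w a * \<psi> s))"
    unfolding wavelet_transform_def
    using b by (subst lborel_integral_real_affine[where c = b and t = a]) (auto simp: algebra_simps)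
  also have "\<dots> = b * ((1 / sqrt b) * ((LINT s|lborel. ?f s) + w a * (LINT s|lborel. \<psi> s)))"
    by (simp only: integral_mult_right_zero
        Bochner_Integration.integral_add[OF f integrable_mult_right[OF int]])
  also have "\<dots> = sqrt b * (LINT s|lborel. ?f s)"
    using b by (simp add: zero field_simps flip: real_sqrt_mult)
  finally have W: "wavelet_transform \<psi> w a b = sqrt b * (LINT s|lborel. ?f s)" .
  have "\<bar>LINT s|lborel. ?f s\<bar> \<le> (LINT s|lborel. \<bar>?f s\<bar>)"
    using integral_norm_bound[of lborel ?f] by simp
  also have "\<dots> \<le> (LINT s|lborel. L * b * \<bar>s * \<psi> s\<bar>)"
    using f dom bound by (intro integral_mono) auto
  also have "\<dots> = b * (L * (LINT s|lborel. \<bar>s * \<psi> s\<bar>))"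
    by simp
  finally have "\<bar>wavelet_transform \<psi> w a b\<bar> \<le> sqrt b * (b * (L * (LINT s|lborel. \<bar>s * \<psi> s\<bar>)))"
    using b by (simp add: W abs_mult)
  moreover have "b powr (3 / 2) = sqrt b * b"
    using b powr_add[of b "1/2" 1] by (simp add: powr_half_sqrt)
  ultimately show ?thesis by (simp add: mult_ac)
qed

lemma integrable_inverse_one_plus_square:
  "integrable lborel (\<lambda>t::real. 1 / (1 + t\<^sup>2))"
  using integrable_inverse_1_plus_square[unfolded set_integrable_def]
  by (simp add: einterval_eq_UNIV inverse_eq_divide)

text \<open>The extra factor \<open>t\<close> costs one power, and for \<open>m \<ge> 3\<close> what
  remains decays at least like the inverse square, so \<open>1 / (1 + t\<^sup>2)\<close> dominates
  up to a constant.\<close>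

lemma decay_imp_first_moment_integrable:
  fixes \<psi> :: "real \<Rightarrow> real"
  assumes [measurable]: "\<psi> \<in> borel_measurable borel"
    and decay: "\<And>t. \<bar>\<psi> t\<bar> \<le> K / (1 + \<bar>t\<bar> ^ m)"
    and m: "m \<ge> 3"
  shows "integrable lborel (\<lambda>t. t * \<psi> t)"
proof -
  \<comment> \<open>The sign of \<open>K\<close> is read off from the decay condition at
    \<open>t = 0\<close>, where \<open>m > 0\<close> makes the denominator 1.\<close>
  have "0 \<le> K / (1 + \<bar>0 :: real\<bar> ^ m)"
    using decay[of 0] by linarith
  then have K: "K \<ge> 0" using m by (simp add: power_0_left split: if_splits)
  have "\<bar>t * \<psi> t\<bar> \<le> 2 * K * (1 / (1 + t\<^sup>2))" for t
  proof -
    define r where "r = \<bar>t\<bar>"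
    have r: "r \<ge> 0" by (simp add: r_def)
    have pow: "r ^ j \<le> 1 + r ^ m" if "j \<le> m" for j
    proof (cases "r \<le> 1")
      case True
      then have "r ^ j \<le> 1" using r by (simp add: power_le_one)
      then show ?thesis using zero_le_power[OF r, of m] by linarith
    next
      case False
      then show ?thesis using power_increasing[OF that, of r] by linarith
    qed
    \<comment> \<open>The left side is \<open>r + r ^ 3\<close>; each power is absorbed separately,
      whence the factor 2.\<close>
    have "r * (1 + r\<^sup>2) \<le> 2 * (1 + r ^ m)"
      using pow[of 1] pow[of 3] m by (simp add: algebra_simps power2_eq_square power3_eq_cube)
    then have "K * (r * (1 + r\<^sup>2)) \<le> K * (2 * (1 + r ^ m))"
      using K by (rule mult_left_mono)
    then have "r * (K / (1 + r ^ m)) \<le> 2 * K * (1 / (1 + r\<^sup>2))"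
      using r by (simp add: field_simps add_pos_nonneg)
    moreover have "\<bar>t * \<psi> t\<bar> \<le> r * (K / (1 + r ^ m))"
      unfolding abs_mult r_def by (rule mult_left_mono[OF decay]) simp
    ultimately show ?thesis by (simp add: r_def)
  qed
  then show ?thesis
    by (intro Bochner_Integration.integrable_bound[OF
          integrable_mult_right[OF integrable_inverse_one_plus_square, of "2 * K"]])
      (use K in \<open>auto simp: abs_mult\<close>)
qed

text \<open>Carries componentwise estimates over to an arbitrary norm: expand in the standard basis,
  then use subadditivity and homogeneity.\<close>

lemma is_norm_le_sum_components:
  fixes p :: "real ^ 'n::finite \<Rightarrow> real"
  assumes "is_norm p"
  shows "p x \<le> (\<Sum>i\<in>UNIV. \<bar>x $ i\<bar> * p (axis i 1))"
proof -
  have sub: "p (\<Sum>i\<in>I. f i) \<le> (\<Sum>i\<in>I. p (f i))" if "finite I" for I and f :: "'n \<Rightarrow> real ^ 'n"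
    using that
  proof (induction I)
    case empty
    have "p 0 = 0" using assms unfolding is_norm_def by blast
    then show ?case by simp
  next
    case (insert i I)
    have "p (f i + (\<Sum>i\<in>I. f i)) \<le> p (f i) + p (\<Sum>i\<in>I. f i)"
      using assms unfolding is_norm_def by blast
    with insert show ?case by simp
  qed
  have "p x = p (\<Sum>i\<in>UNIV. x $ i *\<^sub>R axis i 1)"
    by (simp add: basis_expansion flip: scalar_mult_eq_scaleR)
  also have "\<dots> \<le> (\<Sum>i\<in>UNIV. p (x $ i *\<^sub>R axis i 1))"
    by (rule sub) simp
  also have "\<dots> = (\<Sum>i\<in>UNIV. \<bar>x $ i\<bar> * p (axis i 1))"
    using assms by (simp add: is_norm_def)
  finally show ?thesis .
qed

theorem theorem4p17:
  fixes P :: "('d::finite, 'n::finite) ocp"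
    and N n m :: nat
    and \<Phi> :: "(real ^ 'd \<Rightarrow> real ^ 'd) \<Rightarrow> real \<Rightarrow> real ^ 'd \<Rightarrow> real \<Rightarrow> real ^ 'd"
    and S :: "nat \<Rightarrow> real set"
    and w :: "nat \<Rightarrow> real \<Rightarrow> real"
    and \<eta> :: "nat \<Rightarrow> real ^ 'd"
    and v :: "real \<Rightarrow> real ^ 'n"
    and D :: real
    and \<psi> :: "real \<Rightarrow> real"
    and nrm :: "real ^ 'n \<Rightarrow> real"
  assumes "ocp_assms P"
    and "1 \<le> N"
    and "integration_scheme \<Phi>"
    and "quadrature_rule P N S w"
    and "nlp_optimal P N \<Phi> S w \<eta> v"
    and "D > 0"
    and "C_class n \<psi>"
    and "mother_wavelet \<psi>"
    and "vanishing_moments n \<psi>"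
    and "\<exists>K>0. \<forall>t. \<forall>k\<le>n. \<bar>(deriv ^^ k) \<psi> t\<bar> \<le> K / (1 + \<bar>t\<bar> ^ m)"
    and "n \<ge> 2 \<or> m \<ge> 3"
    and "is_norm nrm"
  shows "\<exists>A>0. \<forall>a b. b > 0 \<longrightarrow>
           nrm (wavelet_transform_vec \<psi> (u_hat P N D v) a b) \<le> A * b powr (3 / 2)"
proof -
  have step: "step P N > 0"
    using assms(1,2) by (simp add: step_def ocp_assms_def)
  have mean: "has_bochner_integral lborel \<psi> 0"
    using assms(8) by (simp add: mother_wavelet_def)
  obtain K where K: "\<And>t k. k \<le> n \<Longrightarrow> \<bar>(deriv ^^ k) \<psi> t\<bar> \<le> K / (1 + \<bar>t\<bar> ^ m)"
    using assms(10) by blast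
  have moment: "integrable lborel (\<lambda>t. t * \<psi> t)"
    using assms(11)
  proof
    assume "n \<ge> 2"
    \<comment> \<open>The first moment is then among the vanishing ones, and
      \<open>has_bochner_integral\<close> includes integrability.\<close>
    then have "1 < n" by simp
    then have "has_bochner_integral lborel (\<lambda>t. t ^ 1 * \<psi> t) 0"
      using assms(9) unfolding vanishing_moments_def by blast
    then show ?thesis by (simp add: has_bochner_integral_iff)
  next
    assume "m \<ge> 3"
    then show ?thesis
      using assms(8) K[of 0] by (intro decay_imp_first_moment_integrable) (auto simp: mother_wavelet_def)
  qed
  let ?M = "LINT s|lborel. \<bar>s * \<psi> s\<bar>"
  \<comment> \<open>The constants are fixed per component before \<open>a\<close> and
    \<open>b\<close> appear, so \<open>A\<close> depends on neither.\<close>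
  obtain L where L: "\<And>i. (L i)-lipschitz_on UNIV (\<lambda>t. u_hat P N D v t $ i)"
    using u_hat_component_lipschitz[OF assms(6) step] by metis
  define A where "A = (\<Sum>i\<in>UNIV. L i * ?M * nrm (axis i 1))"
  have nonneg: "0 \<le> nrm x" for x
    using assms(12) by (simp add: is_norm_def)
  have A: "A \<ge> 0"
    unfolding A_def using nonneg lipschitz_on_nonneg[OF L]
    by (intro sum_nonneg mult_nonneg_nonneg integral_nonneg) auto
  \<comment> \<open>\<open>A\<close> is only known to be nonnegative; adding 1 gives the strictly
    positive constant required.\<close>
  have "nrm (wavelet_transform_vec \<psi> (u_hat P N D v) a b) \<le> (A + 1) * b powr (3 / 2)"
    if b: "b > 0" for a b
  proof -
    let ?W = "wavelet_transform_vec \<psi> (u_hat P N D v) a b"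
    have "nrm ?W \<le> (\<Sum>i\<in>UNIV. \<bar>?W $ i\<bar> * nrm (axis i 1))"
      by (rule is_norm_le_sum_components[OF assms(12)])
    also have "\<dots> \<le> (\<Sum>i\<in>UNIV. (L i * ?M * b powr (3 / 2)) * nrm (axis i 1))"
      using wavelet_transform_lipschitz_bound[OF mean moment L b] nonneg
      by (intro sum_mono mult_right_mono) (auto simp: wavelet_transform_vec_def)
    also have "\<dots> = A * b powr (3 / 2)"
      by (simp add: A_def sum_distrib_left sum_distrib_right mult_ac)
    also have "\<dots> \<le> (A + 1) * b powr (3 / 2)"
      by (simp add: algebra_simps)
    finally show ?thesis .
  qed
  with A show ?thesis by (intro exI[of _ "A + 1"]) auto
qed

end
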